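(* Let $\Omega$ be a nonempty open subset of $\mathbb{R}^n$ and let $F\in\mathcal{F}^1(\overline{\Omega})$, where $\overline\Omega$ is the closure of $\Omega$ and $\partial\Omega$ its boundary. Then $$\Gamma^1(F;\Omega)=\max\{\mathrm{Lip}(Df;\Omega),\ \Gamma^1(F;\partial\Omega)\}.$$
   Context: Fix an integer $n\ge 1$; $\mathbb{R}^n$ carries the standard scalar product and Euclidean norm. A 1-field on a nonempty set $D\subset\mathbb{R}^n$ is a map $F$ assigning to each $x\in D$ the polynomial $F(x)(a)=f_x+\langle D_xf,a-x\rangle$ ($a\in\mathbb{R}^n$), where $f_x\in\mathbb{R}$ and $D_xf\in\mathbb{R}^n$. For $x\ne y$ in $D$, $$\Gamma^1(F;x,y)=2\sup_{a\in\mathbb{R}^n}\frac{|F(x)(a)-F(y)(a)|}{\|x-a\|^2+\|y-a\|^2},$$ and for $S\subset D$, $\Gamma^1(F;S)=\sup_{x\ne y\in S}\Gamma^1(F;x,y)$. $\mathcal{F}^1(D)$ is the set of 1-fields on $D$ with $\Gamma^1(F;D)<+\infty$ (Taylorian fields). For $S\subset D$, $\mathrm{Lip}(Df;S)=\sup_{x\neq y\in S}\|D_xf-D_yf\|/\|x-y\|$. A supremum over the empty set is taken to be $0$. *)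

theory Defs
  imports "HOL-Analysis.Analysis"
begin

text \<open>A 1-field sends a point \<open>x\<close> to a first-order jet \<open>(f\<^sub>x, D\<^sub>xf)\<close>, which stands for the affine
  polynomial \<open>a \<mapsto> f\<^sub>x + \<langle>D\<^sub>xf, a - x\<rangle>\<close>. Fields are total functions; a field on \<open>D\<close> is only ever
  inspected at points of \<open>D\<close>.\<close>

type_synonym 'n one_field = "real ^ 'n \<Rightarrow> real \<times> (real ^ 'n)"

definition field_grad :: "'n::finite one_field \<Rightarrow> real ^ 'n \<Rightarrow> real ^ 'n" where
  "field_grad F x = snd (F x)"

definition field_poly :: "'n::finite one_field \<Rightarrow> real ^ 'n \<Rightarrow> real ^ 'n \<Rightarrow> real" where
  "field_poly F x a = fst (F x) + field_grad F x \<bullet> (a - x)"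

text \<open>Suprema are taken in \<^typ>\<open>ennreal\<close>, so unbounded ones are \<open>\<infinity>\<close> and those over the
  empty set are \<open>0\<close>.\<close>

definition Gamma_pt :: "'n::finite one_field \<Rightarrow> real ^ 'n \<Rightarrow> real ^ 'n \<Rightarrow> ennreal" where
  "Gamma_pt F x y =
     2 * (SUP a. ennreal (\<bar>field_poly F x a - field_poly F y a\<bar>
                          / ((norm (x - a))\<^sup>2 + (norm (y - a))\<^sup>2)))"

definition Gamma_on :: "'n::finite one_field \<Rightarrow> (real ^ 'n) set \<Rightarrow> ennreal" where
  "Gamma_on F S = (SUP (x, y) \<in> {(x, y). x \<in> S \<and> y \<in> S \<and> x \<noteq> y}. Gamma_pt F x y)"

definition taylorian_fields :: "(real ^ 'n) set \<Rightarrow> 'n::finite one_field set" where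
  "taylorian_fields D = {F. Gamma_on F D < \<infinity>}"

definition Lip_on :: "'n::finite one_field \<Rightarrow> (real ^ 'n) set \<Rightarrow> ennreal" where
  "Lip_on F S = (SUP (x, y) \<in> {(x, y). x \<in> S \<and> y \<in> S \<and> x \<noteq> y}.
     ennreal (norm (field_grad F x - field_grad F y) / norm (x - y)))"

end

theory Submission imports Defs begin

text \<open>
  Put \<open>M = max (Lip(Df;\<Omega>), \<Gamma>\<^sup>1(F;\<partial>\<Omega>))\<close>, a finite number. The substance is the bound
  \<open>\<Gamma>\<^sup>1(F;\<Omega>) \<le> M\<close>, that is,
  \<open>\<bar>F(x)(a) - F(y)(a)\<bar> \<le> M/2 (\<parallel>x - a\<parallel>\<^sup>2 + \<parallel>y - a\<parallel>\<^sup>2)\<close> for \<open>x, y \<in> \<Omega>\<close> and every point \<open>a\<close> of the space.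
  The point \<open>a\<close> need not lie in \<open>\<Omega>\<close>, and even if it does, the segments from it to \<open>x\<close> and \<open>y\<close> may
  leave \<open>\<Omega>\<close>, so the Lipschitz bound on the gradient cannot simply be integrated.

  The remedy is to move \<open>x\<close> towards \<open>a\<close> along the segment. Say that \<open>z\<close> is Taylor-bounded by \<open>x\<close>
  if \<open>\<bar>F(x)(z) - f\<^sub>z\<bar> \<le> M/2 \<parallel>x - z\<parallel>\<^sup>2\<close> and \<open>\<parallel>D\<^sub>xf - D\<^sub>zf\<parallel> \<le> M \<parallel>x - z\<parallel>\<close>. If moreover \<open>z\<close> lies between
  \<open>x\<close> and \<open>a\<close>, then
  \<open>F(x)(a) - F(z)(a) = (F(x)(z) - f\<^sub>z) + \<langle>D\<^sub>xf - D\<^sub>zf, a - z\<rangle>\<close> has absolute value at most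
  \<open>M/2 \<parallel>x - z\<parallel>\<^sup>2 + M \<parallel>x - z\<parallel> \<parallel>z - a\<parallel> = M/2 (\<parallel>x - a\<parallel>\<^sup>2 - \<parallel>z - a\<parallel>\<^sup>2)\<close>,
  because the distances add up (\<open>taylor_bound_transport\<close>). So replacing \<open>x\<close> by \<open>z\<close> costs exactly the
  decrease of the right-hand side, and in particular Taylor bounds can be chained along a line
  (\<open>taylor_bound_chain\<close>).

  There are two sources of Taylor bounds: pairs of boundary points, because of
  \<open>\<Gamma>\<^sup>1(F;\<partial>\<Omega>) \<le> M\<close> (\<open>mutual_bound_imp_taylor_bound\<close>), and pairs joined by a segment inside the
  closure, by integrating the gradient (\<open>taylor_bound_segment\<close>). If \<open>a \<notin> \<Omega>\<close>, both \<open>x\<close> and \<open>y\<close> are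
  moved to the first boundary point on the way to \<open>a\<close>, where \<open>\<Gamma>\<^sup>1(F;\<partial>\<Omega>) \<le> M\<close> applies. If
  \<open>a \<in> \<Omega>\<close> and the segment from \<open>x\<close> to \<open>a\<close> meets the boundary, it splits at its first and last
  boundary points into three pieces of these two kinds, so that \<open>x\<close> can be moved all the way to \<open>a\<close>
  (\<open>taylor_bound_within\<close>), and so can \<open>y\<close>.

  The opposite bound holds because \<open>\<Gamma>\<^sup>1\<close> dominates the Lipschitz constant of the gradient and does
  not increase when \<open>\<Omega>\<close> is replaced by its closure, a Taylorian field being continuous.
\<close>

section \<open>Real-valued bounds for a pair of points\<close>

text \<open>For \<open>x \<noteq> y\<close> and \<open>M \<ge> 0\<close> this is \<open>\<Gamma>\<^sup>1(F;x,y) \<le> M\<close> without suprema and quotients, which makes it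
  meaningful, and true, for \<open>x = y\<close> as well.\<close>

definition mutual_bound :: "'n::finite one_field \<Rightarrow> real \<Rightarrow> real ^ 'n \<Rightarrow> real ^ 'n \<Rightarrow> bool" where
  "mutual_bound F M x y \<longleftrightarrow>
     (\<forall>a. \<bar>field_poly F x a - field_poly F y a\<bar> \<le> M / 2 * ((norm (x - a))\<^sup>2 + (norm (y - a))\<^sup>2))"

definition taylor_bound :: "'n::finite one_field \<Rightarrow> real \<Rightarrow> real ^ 'n \<Rightarrow> real ^ 'n \<Rightarrow> bool" where
  "taylor_bound F M x y \<longleftrightarrow>
     \<bar>field_poly F x y - fst (F y)\<bar> \<le> M / 2 * (norm (x - y))\<^sup>2 \<and>
     norm (field_grad F x - field_grad F y) \<le> M * norm (x - y)"

lemma field_poly_self [simp]: "field_poly F x x = fst (F x)"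
  by (simp add: field_poly_def)

lemma mutual_bound_refl: "M \<ge> 0 \<Longrightarrow> mutual_bound F M x x"
  by (simp add: mutual_bound_def)

lemma Gamma_pt_le_iff:
  assumes "x \<noteq> y" "M \<ge> 0"
  shows "Gamma_pt F x y \<le> ennreal M \<longleftrightarrow> mutual_bound F M x y"
proof -
  have pos: "(norm (x - a))\<^sup>2 + (norm (y - a))\<^sup>2 > 0" for a
    using assms(1) by (metis add.commute add_nonneg_pos norm_eq_zero right_minus_eq zero_less_power2
        zero_le_power2)
  have "Gamma_pt F x y \<le> ennreal M \<longleftrightarrow>
      (SUP a. 2 * ennreal (\<bar>field_poly F x a - field_poly F y a\<bar>
                          / ((norm (x - a))\<^sup>2 + (norm (y - a))\<^sup>2))) \<le> ennreal M"
    unfolding Gamma_pt_def by (simp add: SUP_mult_left_ennreal)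
  also have "\<dots> \<longleftrightarrow> (\<forall>a. 2 * ennreal (\<bar>field_poly F x a - field_poly F y a\<bar>
                          / ((norm (x - a))\<^sup>2 + (norm (y - a))\<^sup>2)) \<le> ennreal M)"
    by (simp add: SUP_le_iff)
  also have "\<dots> \<longleftrightarrow> (\<forall>a. 2 * (\<bar>field_poly F x a - field_poly F y a\<bar>
                          / ((norm (x - a))\<^sup>2 + (norm (y - a))\<^sup>2)) \<le> M)"
  proof -
    have "2 * ennreal r \<le> ennreal M \<longleftrightarrow> 2 * r \<le> M" if "r \<ge> 0" for r
    proof -
      have "2 * ennreal r = ennreal (2 * r)"
        using that by (simp add: ennreal_mult)
      then show ?thesis using that assms(2) by (simp add: ennreal_le_iff)
    qed
    then show ?thesis by simp
  qed
  also have "\<dots> \<longleftrightarrow> mutual_bound F M x y"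
    unfolding mutual_bound_def using pos by (simp add: field_simps)
  finally show ?thesis .
qed

lemma Gamma_on_le_iff:
  assumes "M \<ge> 0"
  shows "Gamma_on F S \<le> ennreal M \<longleftrightarrow> (\<forall>x\<in>S. \<forall>y\<in>S. mutual_bound F M x y)"
proof -
  have "Gamma_on F S \<le> ennreal M \<longleftrightarrow>
      (\<forall>x\<in>S. \<forall>y\<in>S. x \<noteq> y \<longrightarrow> Gamma_pt F x y \<le> ennreal M)"
    unfolding Gamma_on_def SUP_le_iff by auto
  also have "\<dots> \<longleftrightarrow> (\<forall>x\<in>S. \<forall>y\<in>S. mutual_bound F M x y)"
    using Gamma_pt_le_iff[OF _ assms] mutual_bound_refl[OF assms] by metis
  finally show ?thesis .
qed

lemma Lip_on_le_iff:
  assumes "M \<ge> 0"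
  shows "Lip_on F S \<le> ennreal M \<longleftrightarrow> M-lipschitz_on S (field_grad F)"
proof -
  have "Lip_on F S \<le> ennreal M \<longleftrightarrow>
      (\<forall>x\<in>S. \<forall>y\<in>S. x \<noteq> y \<longrightarrow> norm (field_grad F x - field_grad F y) / norm (x - y) \<le> M)"
    unfolding Lip_on_def SUP_le_iff using assms by (auto simp: ennreal_le_iff)
  also have "\<dots> \<longleftrightarrow>
      (\<forall>x\<in>S. \<forall>y\<in>S. norm (field_grad F x - field_grad F y) \<le> M * norm (x - y))"
  proof -
    have "(x \<noteq> y \<longrightarrow> norm (field_grad F x - field_grad F y) / norm (x - y) \<le> M) \<longleftrightarrow>
        norm (field_grad F x - field_grad F y) \<le> M * norm (x - y)" for x y
      by (cases "x = y") (auto simp: pos_divide_le_eq)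
    then show ?thesis by simp
  qed
  also have "\<dots> \<longleftrightarrow> M-lipschitz_on S (field_grad F)"
    using assms by (auto simp: lipschitz_on_def dist_norm)
  finally show ?thesis .
qed

text \<open>The gradient bound comes from comparing the two points at distance \<open>\<parallel>x - y\<parallel>/2\<close> from the midpoint
  of \<open>x\<close> and \<open>y\<close>, in the directions of plus and minus \<open>D\<^sub>xf - D\<^sub>yf\<close>: the affine function
  \<open>F(x) - F(y)\<close> changes between them by \<open>\<parallel>D\<^sub>xf - D\<^sub>yf\<parallel> \<parallel>x - y\<parallel>\<close>.\<close>

lemma mutual_bound_imp_taylor_bound:
  assumes "mutual_bound F M x y"
  shows "taylor_bound F M x y"
proof -
  have b: "\<bar>field_poly F x a - field_poly F y a\<bar> \<le> M / 2 * ((norm (x - a))\<^sup>2 + (norm (y - a))\<^sup>2)" for a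
    using assms by (simp add: mutual_bound_def)
  have "norm (field_grad F x - field_grad F y) \<le> M * norm (x - y)"
  proof (cases "x = y \<or> field_grad F x = field_grad F y")
    case True
    moreover have "0 \<le> M" if "x \<noteq> y"
    proof -
      have "0 \<le> M / 2 * (norm (x - y))\<^sup>2"
        using b[of y] by (smt (verit) norm_zero power_zero_numeral right_minus_eq)
      with that show ?thesis by (auto simp: zero_le_mult_iff)
    qed
    ultimately show ?thesis by (cases "x = y") auto
  next
    case False
    define q where "q = field_grad F x - field_grad F y"
    define d where "d = norm (x - y)"
    have q: "norm q > 0" and d: "d > 0" using False by (auto simp: q_def d_def)
    define h where "h = (d / (2 * norm q)) *\<^sub>R q"
    define m where "m = (1/2) *\<^sub>R (x + y)"
    have qh: "q \<bullet> h = d * norm q / 2"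
      using q by (simp add: h_def dot_square_norm power2_eq_square)
    have nh: "norm h = d / 2"
      using q d by (simp add: h_def)
    have xm: "x - (m + h) = (1/2) *\<^sub>R (x - y) - h" "y - (m + h) = - ((1/2) *\<^sub>R (x - y) + h)"
      "x - (m - h) = (1/2) *\<^sub>R (x - y) + h" "y - (m - h) = - ((1/2) *\<^sub>R (x - y) - h)"
      by (auto simp: m_def vec_eq_iff field_simps)
    have par: "(norm ((1/2) *\<^sub>R (x - y) - h))\<^sup>2 + (norm ((1/2) *\<^sub>R (x - y) + h))\<^sup>2 = d\<^sup>2"
    proof -
      have "(norm (u - h))\<^sup>2 + (norm (u + h))\<^sup>2 = 2 * (norm u)\<^sup>2 + 2 * (norm h)\<^sup>2" for u
        by (simp add: dot_square_norm[symmetric] inner_simps inner_commute)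
      then show ?thesis by (simp add: nh d_def power_divide)
    qed
    have "2 * (q \<bullet> h) = (field_poly F x (m + h) - field_poly F y (m + h))
        - (field_poly F x (m - h) - field_poly F y (m - h))"
      by (simp add: field_poly_def q_def inner_simps algebra_simps)
    also have "\<dots> \<le> M / 2 * d\<^sup>2 + M / 2 * d\<^sup>2"
    proof -
      have "\<bar>field_poly F x (m + h) - field_poly F y (m + h)\<bar> \<le> M / 2 * d\<^sup>2"
        using b[of "m + h"] unfolding xm norm_minus_cancel par .
      moreover have "\<bar>field_poly F x (m - h) - field_poly F y (m - h)\<bar> \<le> M / 2 * d\<^sup>2"
        using b[of "m - h"] unfolding xm norm_minus_cancel add.commute[of "(norm (_ + h))\<^sup>2"] par .
      ultimately show ?thesis by linarith
    qed
    finally have "d * norm q \<le> d * (M * d)"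
      by (simp add: qh power2_eq_square algebra_simps)
    then show ?thesis using d by (simp add: q_def d_def)
  qed
  with b[of y] show ?thesis by (simp add: taylor_bound_def)
qed

section \<open>Moving a point along a segment\<close>

lemma norm_closed_segment_split:
  fixes x :: "'a::euclidean_space"
  assumes "z \<in> closed_segment x a"
  shows "norm (x - a) = norm (x - z) + norm (z - a)"
  using assms by (metis between between_mem_segment dist_norm)

text \<open>With \<open>s = \<parallel>x - z\<parallel>\<close> and \<open>t = \<parallel>z - a\<parallel>\<close>, the error of the value contributes \<open>M s\<^sup>2/2\<close> and that of
  the gradient \<open>M s t\<close>. By collinearity \<open>\<parallel>x - a\<parallel> = s + t\<close>, so the sum is the difference of squares.\<close>

lemma taylor_bound_transport:
  assumes "z \<in> closed_segment x a" and "taylor_bound F M x z"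
  shows "\<bar>field_poly F x a - field_poly F z a\<bar> \<le> M / 2 * ((norm (x - a))\<^sup>2 - (norm (z - a))\<^sup>2)"
proof -
  have t: "\<bar>field_poly F x z - fst (F z)\<bar> \<le> M / 2 * (norm (x - z))\<^sup>2"
    "norm (field_grad F x - field_grad F z) \<le> M * norm (x - z)"
    using assms(2) by (auto simp: taylor_bound_def)
  have "field_poly F x a - field_poly F z a
      = (field_poly F x z - fst (F z)) + (field_grad F x - field_grad F z) \<bullet> (a - z)"
    by (simp add: field_poly_def inner_simps)
  moreover have "\<bar>(field_grad F x - field_grad F z) \<bullet> (a - z)\<bar>
      \<le> norm (field_grad F x - field_grad F z) * norm (a - z)"
    by (rule Cauchy_Schwarz_ineq2)
  moreover have "\<dots> \<le> M * norm (x - z) * norm (a - z)"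
    using t(2) by (rule mult_right_mono) simp
  ultimately have "\<bar>field_poly F x a - field_poly F z a\<bar>
      \<le> M / 2 * (norm (x - z))\<^sup>2 + M * norm (x - z) * norm (z - a)"
    using t(1) unfolding norm_minus_commute[of z a] by linarith
  also have "\<dots> = M / 2 * ((norm (x - a))\<^sup>2 - (norm (z - a))\<^sup>2)"
    unfolding norm_closed_segment_split[OF assms(1)] by (simp add: power2_eq_square algebra_simps)
  finally show ?thesis .
qed

lemma taylor_bound_chain:
  assumes z: "z \<in> closed_segment x a" and xz: "taylor_bound F M x z" and za: "taylor_bound F M z a"
  shows "taylor_bound F M x a"
proof -
  have "\<bar>field_poly F x a - fst (F a)\<bar> \<le> M / 2 * (norm (x - a))\<^sup>2"
    using taylor_bound_transport[OF z xz] za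
    unfolding taylor_bound_def right_diff_distrib by linarith
  moreover have "norm (field_grad F x - field_grad F a)
      \<le> norm (field_grad F x - field_grad F z) + norm (field_grad F z - field_grad F a)"
    using norm_triangle_ineq[of "field_grad F x - field_grad F z" "field_grad F z - field_grad F a"]
    by simp
  moreover have "M * norm (x - a) = M * norm (x - z) + M * norm (z - a)"
    by (simp add: norm_closed_segment_split[OF z] distrib_left)
  ultimately show ?thesis
    using xz za by (simp add: taylor_bound_def)
qed

section \<open>Regularity of Taylorian fields\<close>

lemma Taylorian_has_derivative:
  assumes "\<And>x y. x \<in> S \<Longrightarrow> y \<in> S \<Longrightarrow> mutual_bound F K x y" and x: "x \<in> S"
  shows "((\<lambda>y. fst (F y)) has_derivative (\<lambda>h. field_grad F x \<bullet> h)) (at x within S)"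
  unfolding has_derivative_within_alt
proof (intro conjI allI impI)
  show "bounded_linear (\<lambda>h. field_grad F x \<bullet> h)" by (rule bounded_linear_inner_right)
  fix e :: real assume e: "e > 0"
  define d where "d = 2 * e / (\<bar>K\<bar> + 1)"
  have d: "d > 0" using e by (simp add: d_def)
  show "\<exists>d>0. \<forall>y\<in>S. norm (y - x) < d \<longrightarrow>
      norm (fst (F y) - fst (F x) - field_grad F x \<bullet> (y - x)) \<le> e * norm (y - x)"
  proof (intro exI[of _ d] conjI ballI impI d)
    fix y assume y: "y \<in> S" and "norm (y - x) < d"
    then have "norm (y - x) * (\<bar>K\<bar> + 1) \<le> 2 * e"
      by (simp add: d_def pos_less_divide_eq)
    moreover have "norm (y - x) * K \<le> norm (y - x) * (\<bar>K\<bar> + 1)"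
      by (intro mult_left_mono) auto
    ultimately have "K / 2 * norm (y - x) \<le> e" by (simp add: algebra_simps)
    then have "K / 2 * norm (y - x) * norm (y - x) \<le> e * norm (y - x)"
      by (rule mult_right_mono) simp
    moreover have "taylor_bound F K x y"
      using assms y by (blast intro: mutual_bound_imp_taylor_bound)
    then have "\<bar>fst (F y) - fst (F x) - field_grad F x \<bullet> (y - x)\<bar> \<le> K / 2 * (norm (y - x))\<^sup>2"
      by (simp add: taylor_bound_def field_poly_def norm_minus_commute abs_minus_commute algebra_simps)
    ultimately show "norm (fst (F y) - fst (F x) - field_grad F x \<bullet> (y - x)) \<le> e * norm (y - x)"
      by (simp add: power2_eq_square)
  qed
qed

lemma Taylorian_continuous_value:
  assumes "\<And>x y. x \<in> S \<Longrightarrow> y \<in> S \<Longrightarrow> mutual_bound F K x y"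
  shows "continuous_on S (\<lambda>y. fst (F y))"
  unfolding continuous_on_eq_continuous_within
  using Taylorian_has_derivative[OF assms] has_derivative_continuous by blast

lemma mutual_bound_lipschitz_grad:
  assumes "K \<ge> 0" "\<And>x y. x \<in> S \<Longrightarrow> y \<in> S \<Longrightarrow> mutual_bound F K x y"
  shows "K-lipschitz_on S (field_grad F)"
  using assms mutual_bound_imp_taylor_bound[of F K]
  by (auto simp: lipschitz_on_def dist_norm taylor_bound_def)

text \<open>The finite constant \<open>K\<close> on the closure serves only to make the field continuous there; the sharp
  constant \<open>M\<close> then passes to the limit.\<close>

lemma mutual_bound_closure:
  assumes K: "K \<ge> 0" "\<And>x y. x \<in> closure S \<Longrightarrow> y \<in> closure S \<Longrightarrow> mutual_bound F K x y"
    and M: "\<And>x y. x \<in> S \<Longrightarrow> y \<in> S \<Longrightarrow> mutual_bound F M x y"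
    and xy: "x \<in> closure S" "y \<in> closure S"
  shows "mutual_bound F M x y"
  unfolding mutual_bound_def
proof
  fix a
  let ?h = "\<lambda>p. \<bar>field_poly F (fst p) a - field_poly F (snd p) a\<bar>
      - M / 2 * ((norm (fst p - a))\<^sup>2 + (norm (snd p - a))\<^sup>2)"
  have val: "continuous_on (closure S) (\<lambda>y. fst (F y))"
    using K(2) by (rule Taylorian_continuous_value)
  have grad: "continuous_on (closure S) (field_grad F)"
    using mutual_bound_lipschitz_grad[OF K] by (rule lipschitz_on_continuous_on)
  have poly: "continuous_on (closure S) (\<lambda>y. field_poly F y a)"
    unfolding field_poly_def by (intro continuous_intros val grad)
  have "continuous_on (closure (S \<times> S)) ?h"
    by (intro continuous_intros continuous_on_compose2[OF poly]) (auto simp: closure_Times)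
  moreover have "(x, y) \<in> closure (S \<times> S)" using xy by (simp add: closure_Times)
  moreover have "?h p \<le> 0" if "p \<in> S \<times> S" for p
    using M[of "fst p" "snd p"] that by (auto simp: mutual_bound_def)
  ultimately have "?h (x, y) \<le> 0" by (rule continuous_le_on_closure)
  then show "\<bar>field_poly F x a - field_poly F y a\<bar> \<le> M / 2 * ((norm (x - a))\<^sup>2 + (norm (y - a))\<^sup>2)"
    by simp
qed

text \<open>The mean value theorem along the segment turns the possibly large constant \<open>K\<close>, which only
  provides differentiability, into the Lipschitz constant \<open>M\<close> of the gradient.\<close>

lemma taylor_bound_segment:
  assumes K: "\<And>x y. x \<in> S \<Longrightarrow> y \<in> S \<Longrightarrow> mutual_bound F K x y"
    and M: "M-lipschitz_on S (field_grad F)"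
    and seg: "closed_segment x y \<subseteq> S"
  shows "taylor_bound F M x y"
proof -
  define v where "v = y - x"
  define f where "f = (\<lambda>t::real. fst (F (x + t *\<^sub>R v)) - t * (field_grad F x \<bullet> v))"
  define f' where "f' = (\<lambda>t::real. (field_grad F (x + t *\<^sub>R v) - field_grad F x) \<bullet> v)"
  have inS: "x + t *\<^sub>R v \<in> S" if "t \<in> {0..1}" for t
  proof -
    have "x + t *\<^sub>R v = (1 - t) *\<^sub>R x + t *\<^sub>R y" by (simp add: v_def algebra_simps)
    then show ?thesis using that seg by (auto simp: closed_segment_def)
  qed
  have deriv: "(f has_vector_derivative f' t) (at t within {0..1})" if "t \<in> {0..1}" for t
  proof -
    have "((\<lambda>y. fst (F y)) has_derivative (\<lambda>h. field_grad F (x + t *\<^sub>R v) \<bullet> h))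
        (at (x + t *\<^sub>R v) within (\<lambda>t. x + t *\<^sub>R v) ` {0..1})"
      using Taylorian_has_derivative[OF K inS[OF that]]
      by (rule has_derivative_subset) (use inS in auto)
    moreover have "((\<lambda>t. x + t *\<^sub>R v) has_derivative (\<lambda>s. s *\<^sub>R v)) (at t within {0..1})"
      by (auto intro!: derivative_eq_intros)
    ultimately have "((\<lambda>t. fst (F (x + t *\<^sub>R v))) has_derivative
        (\<lambda>s. field_grad F (x + t *\<^sub>R v) \<bullet> (s *\<^sub>R v))) (at t within {0..1})"
      using has_derivative_in_compose by blast
    then have "(f has_derivative (\<lambda>s. field_grad F (x + t *\<^sub>R v) \<bullet> (s *\<^sub>R v)
        - s * (field_grad F x \<bullet> v))) (at t within {0..1})"
      unfolding f_def
      by (rule has_derivative_diff) (auto intro!: derivative_eq_intros)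
    then show ?thesis
      by (simp add: has_vector_derivative_def f'_def inner_simps algebra_simps)
  qed
  have "norm (f 1 - f 0) \<le> M / 2 * 1\<^sup>2 * (norm v)\<^sup>2 - M / 2 * 0\<^sup>2 * (norm v)\<^sup>2"
  proof (rule differentiable_bound_general[where f' = f' and \<phi>' = "\<lambda>t. M * t * (norm v)\<^sup>2"])
    show "continuous_on {0..1} f"
      using deriv has_vector_derivative_continuous
      by (force simp: continuous_on_eq_continuous_within)
    show "continuous_on {0..1} (\<lambda>t. M / 2 * t\<^sup>2 * (norm v)\<^sup>2)" by (intro continuous_intros)
    fix t :: real assume t: "0 < t" "t < 1"
    then show "(f has_vector_derivative f' t) (at t)"
      using deriv[of t] by (simp add: at_within_Icc_at)
    show "((\<lambda>t. M / 2 * t\<^sup>2 * (norm v)\<^sup>2) has_vector_derivative M * t * (norm v)\<^sup>2) (at t)"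
      unfolding has_real_derivative_iff_has_vector_derivative[symmetric]
      by (auto intro!: derivative_eq_intros)
    have "norm (f' t) \<le> norm (field_grad F (x + t *\<^sub>R v) - field_grad F x) * norm v"
      unfolding f'_def by (simp add: Cauchy_Schwarz_ineq2)
    also have "\<dots> \<le> (M * norm (t *\<^sub>R v)) * norm v"
      using lipschitz_onD[OF M inS inS, of t 0] t
      by (intro mult_right_mono) (auto simp: dist_norm)
    finally show "norm (f' t) \<le> M * t * (norm v)\<^sup>2"
      using t by (simp add: power2_eq_square algebra_simps)
  qed simp
  then have "\<bar>field_poly F x y - fst (F y)\<bar> \<le> M / 2 * (norm (x - y))\<^sup>2"
    by (simp add: f_def v_def field_poly_def abs_minus_commute norm_minus_commute algebra_simps)
  moreover have "norm (field_grad F x - field_grad F y) \<le> M * norm (x - y)"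
    using lipschitz_onD[OF M, of x y] seg by (auto simp: dist_norm)
  ultimately show ?thesis by (simp add: taylor_bound_def)
qed

section \<open>Reaching the boundary along a segment\<close>

text \<open>The point of the boundary on the segment that is nearest to \<open>x\<close> will do: if the segment left the
  closure before reaching it, it would have crossed the boundary at a point still nearer to \<open>x\<close>.\<close>

lemma reach_frontier_on_segment:
  fixes x a :: "'a::euclidean_space"
  assumes x: "x \<in> S" and hit: "closed_segment x a \<inter> frontier S \<noteq> {}"
  obtains z where "z \<in> frontier S" "z \<in> closed_segment x a" "closed_segment x z \<subseteq> closure S"
proof -
  have "closed (closed_segment x a \<inter> frontier S)" by (intro closed_Int) auto
  then obtain z where z: "z \<in> closed_segment x a" "z \<in> frontier S"
    and least: "\<And>q. q \<in> closed_segment x a \<inter> frontier S \<Longrightarrow> dist x z \<le> dist x q"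
    using hit distance_attains_inf[of _ x] by (metis IntE)
  have "p \<in> closure S" if p: "p \<in> closed_segment x z" for p
  proof (rule ccontr)
    assume "p \<notin> closure S"
    then have "p \<notin> S" using closure_subset by blast
    then have "closed_segment x p \<inter> frontier S \<noteq> {}"
      using x by (intro connected_Int_frontier) auto
    then obtain q where q: "q \<in> closed_segment x p" "q \<in> frontier S" by blast
    then have "q \<in> closed_segment x a"
      using p z(1) by (meson ends_in_segment(1) subsetD subset_closed_segment)
    then have "dist x z \<le> dist x q" using least q by blast
    moreover have "norm (x - p) = norm (x - q) + norm (q - p)" "norm (x - z) = norm (x - p) + norm (p - z)"
      using norm_closed_segment_split p q by blast+
    ultimately have "norm (q - p) + norm (p - z) \<le> 0" by (simp add: dist_norm)
    then have "norm (q - p) = 0" by (smt (verit) norm_ge_zero)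
    then have "p \<in> frontier S" using q(2) by simp
    then show False using \<open>p \<notin> closure S\<close> by (simp add: frontier_def)
  qed
  then show ?thesis using that z by blast
qed

lemma taylor_bound_within:
  assumes K: "\<And>x y. x \<in> closure \<Omega> \<Longrightarrow> y \<in> closure \<Omega> \<Longrightarrow> mutual_bound F K x y"
    and Lip: "M-lipschitz_on (closure \<Omega>) (field_grad F)"
    and bd: "\<And>x y. x \<in> frontier \<Omega> \<Longrightarrow> y \<in> frontier \<Omega> \<Longrightarrow> mutual_bound F M x y"
    and x: "x \<in> \<Omega>" and a: "a \<in> \<Omega>"
  shows "taylor_bound F M x a"
proof (cases "closed_segment x a \<inter> frontier \<Omega> = {}")
  case True
  then have "closed_segment x a \<subseteq> \<Omega>"
    using connected_Int_frontier[of "closed_segment x a" \<Omega>] x by auto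
  then have "closed_segment x a \<subseteq> closure \<Omega>" using closure_subset by blast
  with K Lip show ?thesis by (rule taylor_bound_segment)
next
  case False
  then obtain z where z: "z \<in> frontier \<Omega>" "z \<in> closed_segment x a" "closed_segment x z \<subseteq> closure \<Omega>"
    using reach_frontier_on_segment[OF x] by metis
  \<comment> \<open>Starting from \<open>a\<close> and walking towards \<open>z\<close> gives a boundary point between \<open>z\<close> and \<open>a\<close>.\<close>
  have "closed_segment a z \<inter> frontier \<Omega> \<noteq> {}" using z(1) by auto
  then obtain w where w: "w \<in> frontier \<Omega>" "w \<in> closed_segment a z" "closed_segment a w \<subseteq> closure \<Omega>"
    using reach_frontier_on_segment[OF a] by metis
  have "taylor_bound F M z a"
  proof (rule taylor_bound_chain)
    show "w \<in> closed_segment z a" using w(2) by (simp add: closed_segment_commute)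
    show "taylor_bound F M z w"
      using bd z(1) w(1) by (blast intro: mutual_bound_imp_taylor_bound)
    show "taylor_bound F M w a"
      using K Lip w(3) by (intro taylor_bound_segment) (auto simp: closed_segment_commute)
  qed
  moreover have "taylor_bound F M x z"
    using K Lip z(3) by (rule taylor_bound_segment)
  ultimately show ?thesis using taylor_bound_chain z(2) by blast
qed

lemma mutual_bound_from_boundary:
  assumes M: "M \<ge> 0"
    and K: "\<And>x y. x \<in> closure \<Omega> \<Longrightarrow> y \<in> closure \<Omega> \<Longrightarrow> mutual_bound F K x y"
    and Lip: "M-lipschitz_on (closure \<Omega>) (field_grad F)"
    and bd: "\<And>x y. x \<in> frontier \<Omega> \<Longrightarrow> y \<in> frontier \<Omega> \<Longrightarrow> mutual_bound F M x y"
    and x: "x \<in> \<Omega>" and y: "y \<in> \<Omega>"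
  shows "mutual_bound F M x y"
  unfolding mutual_bound_def
proof
  fix a
  show "\<bar>field_poly F x a - field_poly F y a\<bar> \<le> M / 2 * ((norm (x - a))\<^sup>2 + (norm (y - a))\<^sup>2)"
  proof (cases "a \<in> \<Omega>")
    case True
    have "taylor_bound F M x a" "taylor_bound F M y a"
      using taylor_bound_within[OF K Lip bd _ True] x y by auto
    then have "\<bar>field_poly F x a - fst (F a)\<bar> \<le> M / 2 * (norm (x - a))\<^sup>2"
      "\<bar>field_poly F y a - fst (F a)\<bar> \<le> M / 2 * (norm (y - a))\<^sup>2"
      by (auto simp: taylor_bound_def)
    then show ?thesis unfolding distrib_left by linarith
  next
    case False
    have move: "\<exists>z\<in>frontier \<Omega>. \<bar>field_poly F p a - field_poly F z a\<bar>
        \<le> M / 2 * ((norm (p - a))\<^sup>2 - (norm (z - a))\<^sup>2)" if p: "p \<in> \<Omega>" for p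
    proof -
      have "closed_segment p a \<inter> frontier \<Omega> \<noteq> {}"
        using p False by (intro connected_Int_frontier) auto
      then obtain z where z: "z \<in> frontier \<Omega>" "z \<in> closed_segment p a" "closed_segment p z \<subseteq> closure \<Omega>"
        using reach_frontier_on_segment[OF p] by metis
      have "taylor_bound F M p z" using K Lip z(3) by (rule taylor_bound_segment)
      with taylor_bound_transport z(1,2) show ?thesis by blast
    qed
    obtain z w where "z \<in> frontier \<Omega>" "w \<in> frontier \<Omega>"
      and zw: "\<bar>field_poly F x a - field_poly F z a\<bar> \<le> M / 2 * ((norm (x - a))\<^sup>2 - (norm (z - a))\<^sup>2)"
        "\<bar>field_poly F y a - field_poly F w a\<bar> \<le> M / 2 * ((norm (y - a))\<^sup>2 - (norm (w - a))\<^sup>2)"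
      using move x y by meson
    then have "\<bar>field_poly F z a - field_poly F w a\<bar> \<le> M / 2 * ((norm (z - a))\<^sup>2 + (norm (w - a))\<^sup>2)"
      using bd by (simp add: mutual_bound_def)
    with zw show ?thesis unfolding distrib_left right_diff_distrib by linarith
  qed
qed

section \<open>The formula for Taylorian fields\<close>

theorem theorem13:
  fixes \<Omega> :: "(real ^ 'n::finite) set" and F :: "'n one_field"
  assumes "open \<Omega>" and "\<Omega> \<noteq> {}"
    and "F \<in> taylorian_fields (closure \<Omega>)"
  shows "Gamma_on F \<Omega> = max (Lip_on F \<Omega>) (Gamma_on F (frontier \<Omega>))"
proof -
  have "Gamma_on F (closure \<Omega>) < \<infinity>"
    using assms(3) by (simp add: taylorian_fields_def)
  then obtain K where K0: "K \<ge> 0" and "Gamma_on F (closure \<Omega>) \<le> ennreal K"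
    by (metis ennreal_cases infinity_ennreal_def order_less_irrefl order_refl)
  then have K: "mutual_bound F K x y" if "x \<in> closure \<Omega>" "y \<in> closure \<Omega>" for x y
    using Gamma_on_le_iff[OF K0] that by blast
  have sub: "\<Omega> \<subseteq> closure \<Omega>" "frontier \<Omega> \<subseteq> closure \<Omega>"
    by (auto simp: closure_subset frontier_def)
  have fin: "Gamma_on F \<Omega> \<le> ennreal K" "Gamma_on F (frontier \<Omega>) \<le> ennreal K"
    unfolding Gamma_on_le_iff[OF K0] using K sub by blast+
  have K_lip: "K-lipschitz_on (closure \<Omega>) (field_grad F)"
    using K0 K by (rule mutual_bound_lipschitz_grad)
  then have fin_lip: "Lip_on F \<Omega> \<le> ennreal K"
    unfolding Lip_on_le_iff[OF K0] using sub(1) by (rule lipschitz_on_subset)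
  show ?thesis
  proof (rule antisym)
    have "max (Lip_on F \<Omega>) (Gamma_on F (frontier \<Omega>)) \<le> ennreal K"
      using fin fin_lip by simp
    then obtain M where M0: "M \<ge> 0" and M: "max (Lip_on F \<Omega>) (Gamma_on F (frontier \<Omega>)) = ennreal M"
      by (metis ennreal_cases ennreal_less_top leD)
    then have "Lip_on F \<Omega> \<le> ennreal M" "Gamma_on F (frontier \<Omega>) \<le> ennreal M"
      by (metis max.cobounded1, metis max.cobounded2)
    then have lip: "M-lipschitz_on \<Omega> (field_grad F)"
      and bd: "\<And>x y. x \<in> frontier \<Omega> \<Longrightarrow> y \<in> frontier \<Omega> \<Longrightarrow> mutual_bound F M x y"
      by (auto simp: Lip_on_le_iff[OF M0] Gamma_on_le_iff[OF M0])
    have "M-lipschitz_on (closure \<Omega>) (field_grad F)"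
      using lip lipschitz_on_continuous_on[OF K_lip] by (rule lipschitz_on_closure)
    then show "Gamma_on F \<Omega> \<le> max (Lip_on F \<Omega>) (Gamma_on F (frontier \<Omega>))"
      unfolding M Gamma_on_le_iff[OF M0]
      using mutual_bound_from_boundary[OF M0 K _ bd] by blast
  next
    obtain M where M0: "M \<ge> 0" and M: "Gamma_on F \<Omega> = ennreal M"
      using fin(1) by (metis ennreal_cases ennreal_less_top leD)
    then have mb: "\<And>x y. x \<in> \<Omega> \<Longrightarrow> y \<in> \<Omega> \<Longrightarrow> mutual_bound F M x y"
      using Gamma_on_le_iff[OF M0] by (metis order_refl)
    have "Lip_on F \<Omega> \<le> ennreal M"
      unfolding Lip_on_le_iff[OF M0] using M0 mb by (rule mutual_bound_lipschitz_grad)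
    moreover have "Gamma_on F (frontier \<Omega>) \<le> ennreal M"
      unfolding Gamma_on_le_iff[OF M0]
      using mutual_bound_closure[OF K0 K mb] sub(2) by blast
    ultimately show "max (Lip_on F \<Omega>) (Gamma_on F (frontier \<Omega>)) \<le> Gamma_on F \<Omega>"
      by (simp add: M)
  qed
qed

end
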